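(* Let $A\subset \mathbb{R}$ be Lebesgue measurable, and suppose that $B\subset \mathbb{R}$ is $d$-closed and is a $G_\delta$ set in the Euclidean topology of $\mathbb{R}$. If every null subset of $A$ can be translated into $B$, then $A$ can be translated into $B$.
   Context: A set $E\subset\mathbb{R}$ is null if its Lebesgue measure is $0$. A set $E\subset \mathbb{R}$ can be translated into a set $F\subset\mathbb{R}$ if there exists a real number $x$ such that $E+x=\{e+x : e\in E\}\subset F$. For a Lebesgue measurable set $E\subset\mathbb{R}$, with $|\cdot|$ denoting Lebesgue measure, the density of $E$ at $x$ is $d(E,x)=\lim_{h\to 0^+}\frac{|E\cap[x-h,x+h]|}{2h}$ (when the limit exists), and the upper density of $E$ at $x$ is $\overline{d}(E,x)=\limsup_{h\to 0^+}\frac{|E\cap[x-h,x+h]|}{2h}$. A set $G\subset \mathbb{R}$ is $d$-open if $G$ is Lebesgue measurable and $d(G,x)=1$ for every $x\in G$. A set $B\subset\mathbb{R}$ is $d$-closed if $\mathbb{R}\setminus B$ is $d$-open; that is, if $B$ is Lebesgue measurable and contains every point $x$ such that $\overline{d}(B,x)>0$. *)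

theory Defs
  imports "HOL-Analysis.Analysis"
begin

definition translatable_into :: "real set \<Rightarrow> real set \<Rightarrow> bool" where
  "translatable_into E F \<longleftrightarrow> (\<exists>x. (\<lambda>e. e + x) ` E \<subseteq> F)"

text \<open>The density is a relation rather than a function, because the limit need not exist.
  It is only meaningful for Lebesgue measurable \<open>E\<close>; then \<open>E \<inter> {x - h..x + h}\<close> has finite
  measure, so that the real-valued \<open>measure\<close> is the Lebesgue measure of this set.\<close>

definition has_density :: "real set \<Rightarrow> real \<Rightarrow> real \<Rightarrow> bool" where
  "has_density E d x \<longleftrightarrow>
     ((\<lambda>h. measure lebesgue (E \<inter> {x - h..x + h}) / (2 * h)) \<longlongrightarrow> d) (at_right 0)"

definition d_open :: "real set \<Rightarrow> bool" where
  "d_open G \<longleftrightarrow> G \<in> sets lebesgue \<and> (\<forall>x\<in>G. has_density G 1 x)"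

definition d_closed :: "real set \<Rightarrow> bool" where
  "d_closed B \<longleftrightarrow> d_open (- B)"

end

theory Submission
  imports Defs
begin

text \<open>Put \<open>G = - B\<close>. A null part of \<open>A\<close> consists of the points where \<open>A\<close> has lower density zero.
  If \<open>a\<close> is another point of \<open>A\<close> and \<open>a + x \<in> G\<close>, then \<open>A \<inter> (G - x)\<close> has positive measure, because
  \<open>G\<close> has density 1 at \<open>a + x\<close>. So it is enough to find a null set \<open>N \<subseteq> A\<close> which meets
  \<open>A \<inter> (G - x)\<close> for every \<open>x\<close> for which this set has positive measure. By inner regularity \<open>A\<close> and \<open>G\<close>
  may be replaced by compact sets \<open>K\<close> and \<open>F\<close>. Intersecting \<open>K\<close> with a fine enough periodic pattern
  of density 1/2 nearly halves the measures of \<open>K\<close> and of all the sets \<open>K \<inter> (F - x)\<close>, uniformly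
  in \<open>x\<close>, and iterating this gives \<open>N\<close> as the intersection of a decreasing sequence of compact
  sets.\<close>

section \<open>Uniform halving of compact sets\<close>

text \<open>Outer regularity gives an open \<open>U\<close> around \<open>K\<close> with
  \<open>U - K\<close> of measure below \<open>e\<close>. By compactness a whole
  \<open>d\<close>-neighbourhood of \<open>K\<close> lies in \<open>U\<close>, so a shift by less
  than \<open>d\<close> moves points of \<open>K\<close> out of \<open>K\<close> only into
  \<open>U - K\<close>.\<close>

lemma compact_translation_Diff_small:
  fixes K :: "'a::euclidean_space set"
  assumes "compact K" "e > 0"
  obtains d where "d > 0" "\<And>h. norm h < d \<Longrightarrow> measure lebesgue ((+) h ` K - K) < e"
proof -
  have "K \<in> sets lebesgue"
    using assms(1) lmeasurable_compact by blast
  then obtain U where U: "open U" "K \<subseteq> U" "U - K \<in> lmeasurable" "emeasure lebesgue (U - K) < ennreal e"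
    using sets_lebesgue_outer_open assms(2) by metis
  then have less: "measure lebesgue (U - K) < e"
    using assms(2) by (metis emeasure_eq_measure2 ennreal_less_iff measure_nonneg)
  obtain d where d: "d > 0" "(\<Union>x\<in>K. ball x d) \<subseteq> U"
    using compact_subset_open_imp_ball_epsilon_subset[OF assms(1) U(1,2)] by blast
  show thesis
  proof
    fix h :: 'a assume "norm h < d"
    then have "(+) h ` K - K \<subseteq> U - K"
      using d(2) by (fastforce simp: dist_norm)
    moreover have "(+) h ` K - K \<in> sets lebesgue"
      using assms(1) lmeasurable_compact[of K] measurable_translation[of K h]
      by (simp add: fmeasurable.Diff fmeasurableD)
    ultimately have "measure lebesgue ((+) h ` K - K) \<le> measure lebesgue (U - K)"
      using U(3) by (intro measure_mono_fmeasurable) auto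
    with less show "measure lebesgue ((+) h ` K - K) < e" by simp
  qed (fact d(1))
qed

text \<open>For \<open>h > 0\<close> this is the union of the intervals from \<open>2ih\<close> to
  \<open>(2i+1)h\<close> over all integers \<open>i\<close>. In the sine form closedness is
  immediate and the shift by half a period is just a change of sign.\<close>

definition stripes :: "real \<Rightarrow> real set"
  where "stripes h = {x. 0 \<le> sin (pi / h * x)}"

lemma closed_stripes: "closed (stripes h)"
  unfolding stripes_def by (intro closed_Collect_le continuous_intros)

lemma sin_stripes_shift: "h \<noteq> 0 \<Longrightarrow> sin (pi / h * (h + x)) = - sin (pi / h * x)"
  by (simp add: distrib_left sin_add)

text \<open>The shift by \<open>h\<close> swaps \<open>stripes h\<close> with the opposite pattern.
  Hence it maps each half of \<open>E\<close> into the other half, apart from points that leave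
  \<open>E\<close>, and the measures of the halves differ by at most the measure of those
  points.\<close>

lemma measure_stripes_half:
  assumes E: "E \<in> lmeasurable" and h: "h \<noteq> 0"
  shows "\<bar>2 * measure lebesgue (E \<inter> stripes h) - measure lebesgue E\<bar>
           \<le> measure lebesgue ((+) h ` E - E)"
proof -
  let ?m = "measure lebesgue" and ?T = "stripes h"
  define T' where "T' = {x. sin (pi / h * x) \<le> 0}"
  have "closed T'"
    unfolding T'_def by (intro closed_Collect_le continuous_intros)
  then have T': "T' \<in> sets lebesgue" by simp
  have T: "?T \<in> sets lebesgue" using closed_stripes by simp
  \<comment> \<open>The two patterns share only the zeros of the sine. These are countable, so the
    measures of the two halves of \<open>E\<close> add up to that of \<open>E\<close>.\<close>
  have "?T \<inter> T' \<subseteq> range (\<lambda>i::int. i * h)"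
  proof
    fix x assume "x \<in> ?T \<inter> T'"
    then have "sin (pi / h * x) = 0" by (auto simp: stripes_def T'_def)
    then obtain i :: int where "pi / h * x = i * pi" by (auto simp: sin_zero_iff_int2)
    then have "x = i * h" using h by (simp add: field_simps)
    then show "x \<in> range (\<lambda>i::int. i * h)" by blast
  qed
  then have "negligible (?T \<inter> T')"
    using null_sets_completionI[OF countable_imp_null_set_lborel]
    by (meson countable_image countable_subset countableI_type negligible_iff_null_sets)
  then have neg: "negligible ((E \<inter> ?T) \<inter> (E \<inter> T'))"
    by (rule negligible_subset) auto
  have meas: "E \<inter> ?T \<in> lmeasurable" "E \<inter> T' \<in> lmeasurable" "(+) h ` E - E \<in> lmeasurable"
    using E T T' by (auto intro: fmeasurable_Int_fmeasurable measurable_translation fmeasurable.Diff)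
  have "E = (E \<inter> ?T) \<union> (E \<inter> T')" by (auto simp: stripes_def T'_def)
  then have sum: "?m E = ?m (E \<inter> ?T) + ?m (E \<inter> T')"
    using measure_Un3[OF meas(1,2)] neg by (simp add: negligible_imp_measure0)
  have shift: "?m P \<le> ?m Q + ?m ((+) h ` E - E)"
    if "P \<in> lmeasurable" "Q \<in> lmeasurable" "(+) h ` P \<subseteq> Q \<union> ((+) h ` E - E)" for P Q
  proof -
    have "?m P = ?m ((+) h ` P)" by (simp add: measure_translation)
    also have "\<dots> \<le> ?m (Q \<union> ((+) h ` E - E))"
      using that meas(3)
      by (intro measure_mono_fmeasurable)
        (auto intro!: fmeasurable.Un fmeasurableD[OF measurable_translation])
    also have "\<dots> \<le> ?m Q + ?m ((+) h ` E - E)"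
      using that meas(3) by (intro measure_Un_le) auto
    finally show ?thesis .
  qed
  have "(+) h ` (E \<inter> ?T) \<subseteq> (E \<inter> T') \<union> ((+) h ` E - E)"
    "(+) h ` (E \<inter> T') \<subseteq> (E \<inter> ?T) \<union> ((+) h ` E - E)"
    using sin_stripes_shift[OF h] by (auto simp: stripes_def T'_def)
  then have "?m (E \<inter> ?T) \<le> ?m (E \<inter> T') + ?m ((+) h ` E - E)"
    "?m (E \<inter> T') \<le> ?m (E \<inter> ?T) + ?m ((+) h ` E - E)"
    using shift meas by blast+
  with sum show ?thesis by linarith
qed

text \<open>One \<open>h\<close> serves all \<open>y\<close>: what leaves
  \<open>K \<inter> (F + y)\<close> under the shift by \<open>h\<close> leaves either
  \<open>K\<close> or \<open>F + y\<close>, and the measure of the latter part does not depend on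
  \<open>y\<close>.\<close>

lemma uniform_halving:
  fixes K F :: "real set"
  assumes K: "compact K" and F: "compact F" and e: "e > 0"
  obtains L where "compact L" "L \<subseteq> K" "measure lebesgue L \<le> measure lebesgue K / 2 + e"
    "\<And>y. measure lebesgue (K \<inter> (+) y ` F) / 2 - e \<le> measure lebesgue (L \<inter> (+) y ` F)"
proof -
  let ?m = "measure lebesgue"
  obtain d1 where d1: "d1 > 0" "\<And>h. norm h < d1 \<Longrightarrow> ?m ((+) h ` K - K) < e"
    using compact_translation_Diff_small[OF K e] by blast
  obtain d2 where d2: "d2 > 0" "\<And>h. norm h < d2 \<Longrightarrow> ?m ((+) h ` F - F) < e"
    using compact_translation_Diff_small[OF F e] by blast
  define h where "h = min d1 d2 / 2"
  have h: "h \<noteq> 0" "norm h < d1" "norm h < d2" using d1(1) d2(1) by (auto simp: h_def)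
  have lK: "K \<in> lmeasurable" "F \<in> lmeasurable" using K F lmeasurable_compact by auto
  show thesis
  proof
    show "compact (K \<inter> stripes h)" "K \<inter> stripes h \<subseteq> K"
      using K closed_stripes by auto
    show "?m (K \<inter> stripes h) \<le> ?m K / 2 + e"
      using measure_stripes_half[OF lK(1) h(1)] d1(2)[OF h(2)] e by linarith
    fix y
    let ?E = "K \<inter> (+) y ` F"
    have E: "?E \<in> lmeasurable" using lK by (intro fmeasurable.Int measurable_translation)
    have l: "(+) h ` K - K \<in> lmeasurable" "(+) y ` ((+) h ` F - F) \<in> lmeasurable"
      by (intro measurable_translation fmeasurable.Diff fmeasurableD lK)+
    have "(+) h ` ?E - ?E \<subseteq> ((+) h ` K - K) \<union> (+) y ` ((+) h ` F - F)"
      by (auto simp: image_iff algebra_simps)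
    then have "?m ((+) h ` ?E - ?E) \<le> ?m (((+) h ` K - K) \<union> (+) y ` ((+) h ` F - F))"
      using l E by (intro measure_mono_fmeasurable) 
        (auto intro!: fmeasurable.Un fmeasurable.Diff measurable_translation fmeasurableD)
    also have "\<dots> \<le> ?m ((+) h ` K - K) + ?m ((+) y ` ((+) h ` F - F))"
      using l by (intro measure_Un_le) auto
    also have "\<dots> < e + e"
      using d1(2)[OF h(2)] d2(2)[OF h(3)] by (simp add: measure_translation)
    finally have "?m ?E / 2 - e \<le> ?m (?E \<inter> stripes h)"
      using measure_stripes_half[OF E h(1)] by linarith
    then show "?m ?E / 2 - e \<le> ?m ((K \<inter> stripes h) \<inter> (+) y ` F)"
      by (simp add: Int_ac)
  qed
qed

section \<open>Null sets meeting all translates with essential overlap\<close>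

lemma null_transversal_uniform:
  fixes K F :: "real set"
  assumes K: "compact K" and F: "compact F" and e: "e > 0"
  obtains N where "N \<subseteq> K" "negligible N"
    "\<And>y. e \<le> measure lebesgue (K \<inter> (+) y ` F) \<Longrightarrow> N \<inter> (+) y ` F \<noteq> {}"
proof -
  let ?m = "measure lebesgue"
  \<comment> \<open>The summand 1 keeps \<open>c\<close>, and with it the tolerance \<open>t\<close>
    below, positive even when \<open>K\<close> is null.\<close>
  define c where "c = ?m K + 1"
  have c: "c > 0" by (simp add: c_def add_nonneg_pos)
  define Y where "Y = {y. e \<le> ?m (K \<inter> (+) y ` F)}"
  \<comment> \<open>The factors 3/4 and 1/4 are 1/2 plus or minus 1/4: a halving step may err by a
    quarter of either current bound. The upper bounds still tend to 0 and the lower bounds stay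
    positive.\<close>
  define P where "P n L \<longleftrightarrow> compact L \<and> L \<subseteq> K \<and> ?m L \<le> (3/4)^n * c \<and>
      (\<forall>y\<in>Y. (1/4)^n * e \<le> ?m (L \<inter> (+) y ` F))" for n :: nat and L
  have "\<exists>S. \<forall>n. P n (S n) \<and> S (Suc n) \<subseteq> S n"
  proof (rule dependent_nat_choice)
    show "\<exists>L. P 0 L" using K by (auto simp: P_def c_def Y_def)
  next
    fix L n assume L: "P n L"
    define t where "t = min ((3/4)^n * c) ((1/4)^n * e) / 4"
    have "t > 0" using c e by (simp add: t_def)
    then obtain L' where L': "compact L'" "L' \<subseteq> L" "?m L' \<le> ?m L / 2 + t"
      "\<And>y. ?m (L \<inter> (+) y ` F) / 2 - t \<le> ?m (L' \<inter> (+) y ` F)"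
      using uniform_halving[OF _ F] L unfolding P_def by blast
    have t: "t \<le> (3/4)^n * c / 4" "t \<le> (1/4)^n * e / 4" unfolding t_def by auto
    have "?m L' \<le> (3/4)^Suc n * c"
      using L L'(3) t(1) by (simp add: P_def)
    moreover have "(1/4)^Suc n * e \<le> ?m (L' \<inter> (+) y ` F)" if "y \<in> Y" for y
    proof -
      have "(1/4)^n * e \<le> ?m (L \<inter> (+) y ` F)" using L that by (simp add: P_def)
      with L'(4)[of y] t(2) show ?thesis by simp
    qed
    ultimately have "P (Suc n) L'"
      using L L'(1,2) by (auto simp: P_def)
    with L'(2) show "\<exists>L'. P (Suc n) L' \<and> L' \<subseteq> L" by blast
  qed
  then obtain S where S: "\<And>n. P n (S n)" "\<And>n. S (Suc n) \<subseteq> S n" by blast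
  have dec: "S n \<subseteq> S m" if "m \<le> n" for m n
    using lift_Suc_antimono_le[of S] S(2) that by blast
  have comp: "compact (S n)" for n using S(1) by (simp add: P_def)
  show thesis
  proof
    show "(\<Inter>n. S n) \<subseteq> K" using S(1)[of 0] by (auto simp: P_def)
    show "negligible (\<Inter>n. S n)"
      unfolding negligible_outer_le
    proof (intro allI impI)
      fix r :: real assume "r > 0"
      then obtain n where "(3/4)^n < r / c"
        using c real_arch_pow_inv[of "r / c" "3/4"] by auto
      then have "(3/4)^n * c \<le> r" using c by (simp add: field_simps)
      then show "\<exists>T. (\<Inter>n. S n) \<subseteq> T \<and> T \<in> lmeasurable \<and> ?m T \<le> r"
        using S(1)[of n] lmeasurable_compact[OF comp[of n]]
        by (intro exI[of _ "S n"]) (auto simp: P_def)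
    qed
    fix y assume "e \<le> ?m (K \<inter> (+) y ` F)"
    then have y: "y \<in> Y" by (simp add: Y_def)
    \<comment> \<open>The lower bounds also tend to 0, so measure alone does not give a point of the
      limit set. Positivity makes each stage nonempty, and compactness then yields a common
      point.\<close>
    have "\<Inter> (range (\<lambda>n. S n \<inter> (+) y ` F)) \<noteq> {}"
    proof (rule compact_nest)
      show "compact (S n \<inter> (+) y ` F)" for n
        using comp compact_translation[OF F] by blast
      have "0 < (1/4)^n * e" for n :: nat using e by simp
      then have "0 < ?m (S n \<inter> (+) y ` F)" for n
        using S(1)[of n] y less_le_trans unfolding P_def by blast
      then show "S n \<inter> (+) y ` F \<noteq> {}" for n
        by (metis less_irrefl measure_empty)
      show "S n \<inter> (+) y ` F \<subseteq> S m \<inter> (+) y ` F" if "m \<le> n" for m n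
        using dec[OF that] by blast
    qed
    then show "(\<Inter>n. S n) \<inter> (+) y ` F \<noteq> {}" by blast
  qed
qed

text \<open>A positive measure exceeds some \<open>1 / (n + 1)\<close>, so the union of the null
  sets for these countably many thresholds works.\<close>

lemma null_transversal_compact:
  fixes K F :: "real set"
  assumes K: "compact K" and F: "compact F"
  shows "\<exists>N\<subseteq>K. negligible N \<and>
    (\<forall>y. \<not> negligible (K \<inter> (+) y ` F) \<longrightarrow> N \<inter> (+) y ` F \<noteq> {})"
proof -
  have "\<exists>N\<subseteq>K. negligible N \<and>
      (\<forall>y. 1 / real (Suc n) \<le> measure lebesgue (K \<inter> (+) y ` F) \<longrightarrow> N \<inter> (+) y ` F \<noteq> {})" for n
    using null_transversal_uniform[OF assms, of "1 / real (Suc n)"]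
    by (metis of_nat_0_less_iff zero_less_Suc zero_less_divide_1_iff)
  then obtain N where N: "\<And>n. N n \<subseteq> K" "\<And>n. negligible (N n)"
    "\<And>n y. 1 / real (Suc n) \<le> measure lebesgue (K \<inter> (+) y ` F) \<Longrightarrow> N n \<inter> (+) y ` F \<noteq> {}"
    by metis
  have "(\<Union>n. N n) \<inter> (+) y ` F \<noteq> {}" if "\<not> negligible (K \<inter> (+) y ` F)" for y
  proof -
    have "K \<inter> (+) y ` F \<in> lmeasurable"
      using assms compact_translation by (intro lmeasurable_compact) blast
    with that have "0 < measure lebesgue (K \<inter> (+) y ` F)"
      by (simp add: negligible_iff_measure zero_less_measure_iff)
    then obtain n where "1 / real (Suc n) < measure lebesgue (K \<inter> (+) y ` F)"
      using nat_approx_posE by blast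
    then show ?thesis using N(3)[of n y] by fastforce
  qed
  with N show ?thesis
    by (intro exI[of _ "\<Union>n. N n"]) (auto intro: negligible_Union_nat)
qed

lemma lebesgue_set_almost_Union_compact:
  fixes S :: "'a::euclidean_space set"
  assumes "S \<in> sets lebesgue"
  obtains F :: "nat \<Rightarrow> 'a set" and Z
  where "\<And>n. compact (F n)" "negligible Z" "S = (\<Union>n. F n) \<union> Z"
proof -
  obtain C T where C: "fsigma C" "T \<in> null_sets lebesgue" "C \<union> T = S"
    using lebesgue_set_almost_fsigma[OF assms] by metis
  obtain F :: "nat \<Rightarrow> 'a set" where "range F \<subseteq> Collect compact" "C = \<Union>(F ` UNIV)"
    using C(1) fsigma_Union_compact by metis
  with C show thesis
    by (intro that[of F T]) (auto simp: negligible_iff_null_sets)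
qed

text \<open>Up to null sets, \<open>A\<close> and \<open>G\<close> are countable unions of compact
  sets, and the null remainders stay null under every translation. An essential overlap therefore
  already occurs between two compact pieces, and the null sets of the countably many pairs can be
  united.\<close>

lemma null_transversal:
  fixes A G :: "real set"
  assumes "A \<in> sets lebesgue" "G \<in> sets lebesgue"
  shows "\<exists>N\<subseteq>A. negligible N \<and>
    (\<forall>y. \<not> negligible (A \<inter> (+) y ` G) \<longrightarrow> N \<inter> (+) y ` G \<noteq> {})"
proof -
  obtain K :: "nat \<Rightarrow> real set" and Z
    where K: "\<And>n. compact (K n)" "negligible Z" "A = (\<Union>n. K n) \<union> Z"
    using lebesgue_set_almost_Union_compact[OF assms(1)] by metis
  obtain F :: "nat \<Rightarrow> real set" and W
    where F: "\<And>n. compact (F n)" "negligible W" "G = (\<Union>n. F n) \<union> W"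
    using lebesgue_set_almost_Union_compact[OF assms(2)] by metis
  obtain N where N: "\<And>i j. N i j \<subseteq> K i" "\<And>i j. negligible (N i j)"
    "\<And>i j y. \<not> negligible (K i \<inter> (+) y ` F j) \<Longrightarrow> N i j \<inter> (+) y ` F j \<noteq> {}"
  proof -
    have "\<forall>i j. \<exists>N\<subseteq>K i. negligible N \<and>
        (\<forall>y. \<not> negligible (K i \<inter> (+) y ` F j) \<longrightarrow> N \<inter> (+) y ` F j \<noteq> {})"
      using null_transversal_compact[OF K(1) F(1)] by blast
    then show ?thesis unfolding choice_iff using that by blast
  qed
  show ?thesis
  proof (intro exI conjI allI impI)
    show "(\<Union>i j. N i j) \<subseteq> A" using N(1) K(3) by blast
    show "negligible (\<Union>i j. N i j)" using N(2) by (intro negligible_Union_nat)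
    fix y assume y: "\<not> negligible (A \<inter> (+) y ` G)"
    have "A \<inter> (+) y ` G \<subseteq> (\<Union>i j. K i \<inter> (+) y ` F j) \<union> Z \<union> (+) y ` W"
      unfolding K(3) F(3) by blast
    then have "\<not> negligible (\<Union>i j. K i \<inter> (+) y ` F j)"
      using y K(2) negligible_translation[OF F(2)] negligible_Un negligible_subset by metis
    then obtain i j where "\<not> negligible (K i \<inter> (+) y ` F j)"
      by (meson negligible_Union_nat)
    then obtain z where "z \<in> N i j" "z \<in> (+) y ` F j" using N(3) by blast
    moreover have "(+) y ` F j \<subseteq> (+) y ` G" using F(3) by auto
    ultimately have "z \<in> (\<Union>i j. N i j) \<inter> (+) y ` G" by auto
    then show "(\<Union>i j. N i j) \<inter> (+) y ` G \<noteq> {}" by (metis empty_iff)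
  qed
qed

section \<open>Density arguments\<close>

lemma lmeasurable_Int_cbox:
  "A \<in> sets lebesgue \<Longrightarrow> A \<inter> cbox a b \<in> lmeasurable"
  using fmeasurable_Int_fmeasurable[OF lmeasurable_cbox] by (metis Int_commute)

text \<open>The exceptional set \<open>Z\<close> consists of the points of \<open>A\<close> where
  \<open>A\<close> has lower density zero. Around each of them, arbitrarily small balls meet
  \<open>Z\<close> inside a set of arbitrarily small relative measure, which forces \<open>Z\<close>
  to be negligible.\<close>

lemma positive_lower_density_outside_null:
  fixes A :: "real set"
  assumes A: "A \<in> sets lebesgue"
  shows "\<exists>Z\<subseteq>A. negligible Z \<and> (\<forall>a\<in>A - Z. \<exists>r>0. \<exists>e>0. \<forall>d. 0 < d \<longrightarrow> d \<le> r \<longrightarrow>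
      e * (2 * d) \<le> measure lebesgue (A \<inter> {a - d..a + d}))"
proof -
  let ?m = "measure lebesgue"
  define Q where "Q a r e \<longleftrightarrow> (\<forall>d. 0 < d \<longrightarrow> d \<le> r \<longrightarrow> e * (2 * d) \<le> ?m (A \<inter> {a - d..a + d}))"
    for a r e
  define Z where "Z = {a \<in> A. \<forall>r>0. \<forall>e>0. \<not> Q a r e}"
  have "Z \<subseteq> A" by (auto simp: Z_def)
  moreover have "negligible Z"
    unfolding negligible_eq_zero_density
  proof (intro ballI allI impI)
    fix a r e :: real assume "a \<in> Z" "r > 0" "e > 0"
    then have "\<not> Q a r e" by (simp add: Z_def)
    then obtain d where d: "0 < d" "d \<le> r" "?m (A \<inter> {a - d..a + d}) < e * (2 * d)"
      by (auto simp: Q_def not_le)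
    have "ball a d = {a - d<..<a + d}" by (auto simp: dist_real_def)
    then have "?m (ball a d) = 2 * d" "ball a d \<subseteq> {a - d..a + d}" using d(1) by auto
    moreover have "A \<inter> {a - d..a + d} \<in> lmeasurable"
      using lmeasurable_Int_cbox[OF A, of "a - d" "a + d"] by simp
    ultimately show "\<exists>d. 0 < d \<and> d \<le> r \<and> (\<exists>U. Z \<inter> ball a d \<subseteq> U \<and> U \<in> lmeasurable \<and>
        ?m U < e * ?m (ball a d))"
      using d \<open>Z \<subseteq> A\<close> by (intro exI[of _ d] conjI exI[of _ "A \<inter> {a - d..a + d}"]) auto
  qed
  moreover have "\<forall>a\<in>A - Z. \<exists>r>0. \<exists>e>0. Q a r e" by (auto simp: Z_def)
  ultimately show ?thesis unfolding Q_def by blast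
qed

text \<open>In a short interval around \<open>a\<close>, the set \<open>A\<close> fills at least the
  proportion \<open>e\<close> and \<open>G - x\<close> more than \<open>1 - e\<close>. With a null
  overlap the two would have more measure than the interval.\<close>

lemma not_negligible_Int_of_density_1:
  assumes A: "A \<in> sets lebesgue" and G: "G \<in> sets lebesgue"
    and dens: "has_density G 1 (a + x)" and "r > 0" "e > 0"
    and low: "\<And>d. 0 < d \<Longrightarrow> d \<le> r \<Longrightarrow> e * (2 * d) \<le> measure lebesgue (A \<inter> {a - d..a + d})"
  shows "\<not> negligible (A \<inter> (+) (- x) ` G)"
proof
  let ?m = "measure lebesgue"
  assume neg: "negligible (A \<inter> (+) (- x) ` G)"
  have "\<forall>\<^sub>F h in at_right 0. 1 - e < ?m (G \<inter> {a + x - h..a + x + h}) / (2 * h)"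
    using dens \<open>e > 0\<close> unfolding has_density_def by (intro order_tendstoD) auto
  moreover have "\<forall>\<^sub>F h in at_right 0. h \<in> {0<..<r}"
    using \<open>r > 0\<close> by (rule eventually_at_right_real)
  ultimately have "\<forall>\<^sub>F h in at_right 0. h \<in> {0<..<r} \<and>
      1 - e < ?m (G \<inter> {a + x - h..a + x + h}) / (2 * h)"
    by eventually_elim auto
  then have "\<exists>h. h \<in> {0<..<r} \<and> 1 - e < ?m (G \<inter> {a + x - h..a + x + h}) / (2 * h)"
    by (rule eventually_happens'[OF trivial_limit_at_right_real])
  then obtain h where h: "0 < h" "h < r" "1 - e < ?m (G \<inter> {a + x - h..a + x + h}) / (2 * h)"
    by auto
  define P where "P = A \<inter> {a - h..a + h}"
  define Q where "Q = (+) (- x) ` (G \<inter> {a + x - h..a + x + h})"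
  have lm: "P \<in> lmeasurable" "Q \<in> lmeasurable"
    unfolding P_def Q_def
    using lmeasurable_Int_cbox[OF A, of "a - h" "a + h"]
      lmeasurable_Int_cbox[OF G, of "a + x - h" "a + x + h"]
    by (simp_all only: measurable_translation cbox_interval)
  have "P \<inter> Q \<subseteq> A \<inter> (+) (- x) ` G" by (auto simp: P_def Q_def)
  then have "?m (P \<union> Q) = ?m P + ?m Q"
    using measure_Un3[OF lm] neg by (simp add: negligible_imp_measure0 negligible_subset)
  moreover have "?m (P \<union> Q) \<le> ?m {a - h..a + h}"
    using lm by (intro measure_mono_fmeasurable) (auto simp: P_def Q_def)
  ultimately have "?m P + ?m Q \<le> 2 * h" using h(1) by simp
  moreover have "e * (2 * h) \<le> ?m P" using low h by (simp add: P_def)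
  moreover have "(1 - e) * (2 * h) < ?m Q"
    using h unfolding Q_def measure_translation by (simp add: field_simps)
  ultimately show False by (simp add: algebra_simps)
qed

theorem theorem1p2:
  fixes A B :: "real set"
  assumes "A \<in> sets lebesgue"
    and "d_closed B"
    and "gdelta_in euclidean B"
    and "\<And>N. N \<subseteq> A \<Longrightarrow> N \<in> null_sets lebesgue \<Longrightarrow> translatable_into N B"
  shows "translatable_into A B"
proof -
  have G: "- B \<in> sets lebesgue" "\<And>g. g \<in> - B \<Longrightarrow> has_density (- B) 1 g"
    using assms(2) by (auto simp: d_closed_def d_open_def)
  obtain Z where Z: "Z \<subseteq> A" "negligible Z"
    "\<And>a. a \<in> A - Z \<Longrightarrow> \<exists>r>0. \<exists>e>0. \<forall>d. 0 < d \<longrightarrow> d \<le> r \<longrightarrow>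
      e * (2 * d) \<le> measure lebesgue (A \<inter> {a - d..a + d})"
    using positive_lower_density_outside_null[OF assms(1)] by blast
  obtain N where N: "N \<subseteq> A" "negligible N"
    "\<And>y. \<not> negligible (A \<inter> (+) y ` (- B)) \<Longrightarrow> N \<inter> (+) y ` (- B) \<noteq> {}"
    using null_transversal[OF assms(1) G(1)] by blast
  \<comment> \<open>The hypothesis is applied to the union so that one \<open>x\<close> serves both
    sets: \<open>Z\<close> takes care of the points of lower density zero, \<open>N\<close> of all
    others.\<close>
  have "Z \<union> N \<in> null_sets lebesgue"
    using Z(2) N(2) by (simp add: negligible_Un flip: negligible_iff_null_sets)
  then obtain x where x: "(\<lambda>e. e + x) ` (Z \<union> N) \<subseteq> B"
    using assms(4) Z(1) N(1) unfolding translatable_into_def by (meson Un_least)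
  have "a + x \<in> B" if a: "a \<in> A" for a
  proof (rule ccontr)
    assume out: "a + x \<notin> B"
    with x a have "a \<in> A - Z" by blast
    then obtain r e where "r > 0" "e > 0"
      "\<And>d. 0 < d \<Longrightarrow> d \<le> r \<Longrightarrow> e * (2 * d) \<le> measure lebesgue (A \<inter> {a - d..a + d})"
      using Z(3) by blast
    \<comment> \<open>If \<open>a + x\<close> lies outside \<open>B\<close>, the complement of
      \<open>B\<close> has density 1 there. The overlap is then essential, so \<open>N\<close> has a
      point that \<open>x\<close> moves out of \<open>B\<close>.\<close>
    then have "\<not> negligible (A \<inter> (+) (- x) ` (- B))"
      using not_negligible_Int_of_density_1[OF assms(1) G(1)] G(2) out by blast
    then obtain b where "b \<in> N" "b \<in> (+) (- x) ` (- B)" using N(3) by blast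
    then have "b + x \<notin> B" by auto
    with x \<open>b \<in> N\<close> show False by blast
  qed
  then show ?thesis unfolding translatable_into_def by blast
qed

end
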